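(* Let $1\le\delta<\Delta$ be integers and let $G$ be a graph with minimum degree $\delta$ and maximum degree $\Delta$. If $\Delta(\delta+1)$ is even, then $\Pi_1(G)\ge\delta^{2\Delta}\Delta^2$, $NK(G)\ge\delta^{\Delta}\Delta$, $NK^*(G)\ge\delta^{\delta\Delta}\Delta^{\Delta}$. If $\Delta(\delta+1)$ is odd, then $\Pi_1(G)\ge\delta^{2(\Delta-1)}(\delta+1)^2\Delta^2$, $NK(G)\ge\delta^{\Delta-1}(\delta+1)\Delta$, $NK^*(G)\ge\delta^{\delta(\Delta-1)}(\delta+1)^{\delta+1}\Delta^{\Delta}$. These inequalities are sharp.
   Context: All graphs are finite, simple and have at least one edge; $d_u$ is the degree of $u$. $\Pi_1(G)=\prod_{u\in V(G)}d_u^2$ (first multiplicative Zagreb index), $NK(G)=\prod_{u\in V(G)}d_u$ (Narumi–Katayama index), $NK^*(G)=\prod_{u\in V(G)}d_u^{d_u}$ (modified Narumi–Katayama index). *)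

theory Defs
  imports "Graph_Theory.Pair_Digraph"
begin

text \<open>
  Finite simple graphs are the symmetric loop-free digraphs of \<^locale>\<open>pair_graph\<close>: an undirected
  edge $uv$ is the pair of arcs $(u,v)$ and $(v,u)$, so the degree of a vertex is its out-degree.
\<close>

definition nonempty_graph :: "'a pair_pre_digraph \<Rightarrow> bool" where
  "nonempty_graph G \<longleftrightarrow> pair_graph G \<and> parcs G \<noteq> {}"

definition vdegree :: "'a pair_pre_digraph \<Rightarrow> 'a \<Rightarrow> nat" where
  "vdegree G u = out_degree (with_proj G) u"

definition min_degree :: "'a pair_pre_digraph \<Rightarrow> nat" where
  "min_degree G = Min (vdegree G ` pverts G)"

definition max_degree :: "'a pair_pre_digraph \<Rightarrow> nat" where
  "max_degree G = Max (vdegree G ` pverts G)"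

text \<open>The first multiplicative Zagreb index.\<close>

definition Pi1 :: "'a pair_pre_digraph \<Rightarrow> nat" where
  "Pi1 G = (\<Prod>u\<in>pverts G. (vdegree G u)\<^sup>2)"

text \<open>The Narumi--Katayama index and its modified version.\<close>

definition NK :: "'a pair_pre_digraph \<Rightarrow> nat" where
  "NK G = (\<Prod>u\<in>pverts G. vdegree G u)"

definition NK_star :: "'a pair_pre_digraph \<Rightarrow> nat" where
  "NK_star G = (\<Prod>u\<in>pverts G. vdegree G u ^ vdegree G u)"

end

theory Submission
  imports Defs
begin

text \<open>
  A vertex $w$ of degree $\Delta$ has $\Delta$ neighbours, each of degree at least $\delta$, and
  all three indices are products of a monotone function of the degree; this gives the even case.
  If $\Delta(\delta+1)$ is odd, then $\delta$ is even and $\Delta$ is odd, so by the handshake lemma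
  not every vertex other than $w$ can have degree $\delta$.

  Extremal graphs are cones over a graph on $\{0,\dots,\Delta-1\}$ that is $(\delta-1)$-regular, up to
  one vertex of degree $\delta$ in the odd case. Such a graph is obtained by joining $x$ and $y$
  whenever $|x-y|$ lies in $\{1,\dots,h\}\cup\{\Delta-h,\dots,\Delta-1\}$, which is a $2h$-regular
  circulant graph, and, if $\delta$ is even, also whenever $|x-y|=\lfloor\Delta/2\rfloor$. The latter
  pairs form a perfect matching for even $\Delta$; for odd $\Delta$ they cover every vertex once
  except for $\lfloor\Delta/2\rfloor$, which is covered twice.
\<close>

section \<open>Degrees\<close>

lemma vdegree_eq_card: "vdegree G u = card {v. (u, v) \<in> parcs G}"
proof -
  have "out_arcs (with_proj G) u = Pair u ` {v. (u, v) \<in> parcs G}"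
    by (auto simp: out_arcs_def)
  then show ?thesis
    by (simp add: vdegree_def out_degree_def card_image inj_on_def)
qed

text \<open>Each pair comes with its reversal, and irreflexivity makes the two distinct. Deleting
  both lowers the cardinality by two and keeps symmetry and irreflexivity.\<close>

lemma even_card_sym_irrefl:
  assumes "finite A" "sym A" "irrefl A"
  shows "even (card A)"
  using assms
proof (induction A rule: finite_psubset_induct)
  case (psubset A)
  show ?case
  proof (cases "A = {}")
    case False
    then obtain u v where uv: "(u, v) \<in> A" by auto
    define B where "B = A - {(u, v), (v, u)}"
    have "(v, u) \<in> A" "u \<noteq> v"
      using uv psubset.prems by (auto dest: symD simp: irrefl_def)
    then have A: "A = insert (u, v) (insert (v, u) B)" and "(u, v) \<noteq> (v, u)"
      using uv by (auto simp: B_def)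
    have "even (card B)"
    proof (rule psubset.IH)
      show "B \<subset> A" using uv by (auto simp: B_def)
      show "sym B" using psubset.prems(1) by (auto simp: B_def sym_def)
      show "irrefl B" using psubset.prems(2) by (auto simp: B_def irrefl_def)
    qed
    moreover have "card A = Suc (Suc (card B))"
      using psubset.hyps \<open>u \<noteq> v\<close> by (subst A) (auto simp: B_def)
    ultimately show ?thesis by simp
  qed simp
qed

context pair_graph
begin

text \<open>Handshake lemma: out-degrees count every arc once, by its tail, and the arcs form a
  symmetric irreflexive relation.\<close>

lemma even_sum_vdegree: "even (\<Sum>u\<in>pverts G. vdegree G u)"
proof -
  have "finite {v. (u, v) \<in> parcs G}" for u
    by (rule finite_subset[OF _ pair_finite_verts]) (auto dest: in_arcsD2)
  then have "(\<Sum>u\<in>pverts G. vdegree G u) = card (SIGMA u:pverts G. {v. (u, v) \<in> parcs G})"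
    using pair_finite_verts by (simp add: vdegree_eq_card)
  also have "(SIGMA u:pverts G. {v. (u, v) \<in> parcs G}) = parcs G"
    using in_arcsD1 by auto
  finally have "(\<Sum>u\<in>pverts G. vdegree G u) = card (parcs G)" .
  moreover have "even (card (parcs G))"
    using pair_finite_arcs pair_sym_arcs
    by (intro even_card_sym_irrefl) (auto simp: symmetric_def irrefl_def dest: pair_no_loops)
  ultimately show ?thesis by simp
qed

lemma vdegree_le_card:
  assumes "w \<in> pverts G"
  shows "vdegree G w \<le> card (pverts G - {w})"
  unfolding vdegree_eq_card
  using pair_finite_verts by (intro card_mono) (auto dest: in_arcsD2 pair_no_loops)

lemma min_degree_le: "u \<in> pverts G \<Longrightarrow> min_degree G \<le> vdegree G u"
  using pair_finite_verts by (simp add: min_degree_def)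

lemma max_degree_attained:
  assumes "parcs G \<noteq> {}"
  obtains w where "w \<in> pverts G" "vdegree G w = max_degree G"
proof -
  have "pverts G \<noteq> {}" using assms in_arcsD1 by auto
  then have "max_degree G \<in> vdegree G ` pverts G"
    using pair_finite_verts unfolding max_degree_def by (intro Max_in) auto
  then show thesis using that by auto
qed

end

section \<open>Lower bounds\<close>

text \<open>Since \<open>1 \<le> c\<close>, surplus factors cannot decrease the product, so
  \<open>k\<close> may be smaller than \<open>card A\<close>.\<close>

lemma power_le_prod:
  fixes g :: "'b \<Rightarrow> nat"
  assumes "\<And>x. x \<in> A \<Longrightarrow> c \<le> g x" "1 \<le> c" "k \<le> card A"
  shows "c ^ k \<le> prod g A"
proof -
  have "c ^ k \<le> (\<Prod>x\<in>A. c)" using assms by (simp add: power_increasing)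
  also have "\<dots> \<le> prod g A" using assms by (intro prod_mono) auto
  finally show ?thesis .
qed

text \<open>The three indices are the cases where \<open>f d\<close> is \<open>d\<^sup>2\<close>,
  \<open>d\<close> and \<open>d ^ d\<close>. Monotonicity and \<open>1 \<le> f 1\<close> make every
  factor at least 1, so vertices beyond the first \<Delta> + 1 do no harm.\<close>

lemma degree_product_ge:
  fixes f :: "nat \<Rightarrow> nat"
  assumes G: "nonempty_graph G" "min_degree G = \<delta>" "max_degree G = \<Delta>"
    and \<delta>: "1 \<le> \<delta>"
    and mono: "\<And>a b. 1 \<le> a \<Longrightarrow> a \<le> b \<Longrightarrow> f a \<le> f b" and f1: "1 \<le> f 1"
  shows "f \<delta> ^ \<Delta> * f \<Delta> \<le> (\<Prod>u\<in>pverts G. f (vdegree G u))"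
    and "odd (\<Delta> * (\<delta> + 1)) \<Longrightarrow>
      f \<delta> ^ (\<Delta> - 1) * f (\<delta> + 1) * f \<Delta> \<le> (\<Prod>u\<in>pverts G. f (vdegree G u))"
proof -
  interpret pair_graph G using G by (simp add: nonempty_graph_def)
  let ?d = "vdegree G"
  obtain w where w: "w \<in> pverts G" "?d w = \<Delta>"
    using G max_degree_attained by (metis nonempty_graph_def)
  define A where "A = pverts G - {w}"
  have fin: "finite A" using pair_finite_verts by (simp add: A_def)
  have card_A: "\<Delta> \<le> card A" using vdegree_le_card w by (metis A_def)
  have deg: "\<delta> \<le> ?d x" if "x \<in> A" for x
    using that min_degree_le G by (auto simp: A_def)
  have f\<delta>: "1 \<le> f \<delta>" using mono[of 1 \<delta>] f1 \<delta> by linarith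
  have f_deg: "f \<delta> \<le> f (?d x)" if "x \<in> A" for x
    using mono \<delta> deg that by simp
  have prod_w: "(\<Prod>u\<in>pverts G. f (?d u)) = f \<Delta> * (\<Prod>u\<in>A. f (?d u))"
    using w pair_finite_verts by (simp add: prod.remove[of _ w] A_def)
  show "f \<delta> ^ \<Delta> * f \<Delta> \<le> (\<Prod>u\<in>pverts G. f (?d u))"
    using power_le_prod[of A "f \<delta>" "\<lambda>u. f (?d u)" \<Delta>] f_deg f\<delta> card_A
    by (simp add: prod_w mult.commute)
  show "f \<delta> ^ (\<Delta> - 1) * f (\<delta> + 1) * f \<Delta> \<le> (\<Prod>u\<in>pverts G. f (?d u))"
    if odd: "odd (\<Delta> * (\<delta> + 1))"
  proof -
    \<comment> \<open>Otherwise the degree sum is \<open>\<Delta> + card A * \<delta>\<close>, which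
      is odd because \<Delta> is odd and \<delta> is even.\<close>
    have "\<exists>u\<in>A. ?d u \<noteq> \<delta>"
    proof (rule ccontr)
      assume "\<not> ?thesis"
      then have "(\<Sum>u\<in>pverts G. ?d u) = \<Delta> + card A * \<delta>"
        using w pair_finite_verts by (simp add: sum.remove[of _ w] A_def)
      then show False using even_sum_vdegree odd by auto
    qed
    then obtain u where u: "u \<in> A" "\<delta> + 1 \<le> ?d u"
      using deg by (metis Suc_eq_plus1 Suc_leI le_neq_implies_less)
    \<comment> \<open>Besides \<open>w\<close> and \<open>u\<close> at least \<Delta> - 1 vertices
      remain.\<close>
    have "f \<delta> ^ (\<Delta> - 1) \<le> (\<Prod>x\<in>A - {u}. f (?d x))"
      using f_deg f\<delta> card_A u fin by (intro power_le_prod) auto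
    moreover have "f (\<delta> + 1) \<le> f (?d u)" using mono u by simp
    ultimately show ?thesis
      using u fin by (simp add: prod_w prod.remove[of _ u] mult.commute mult_le_mono)
  qed
qed

lemma self_power_mono: "1 \<le> a \<Longrightarrow> a \<le> b \<Longrightarrow> a ^ a \<le> b ^ b" for a b :: nat
  by (meson le_trans power_increasing power_mono zero_le)

section \<open>Extremal graphs\<close>

text \<open>The condition is |x - y| \<in> T, put additively because subtraction on naturals
  truncates.\<close>

definition distance_nbrs :: "nat \<Rightarrow> nat set \<Rightarrow> nat \<Rightarrow> nat set" where
  "distance_nbrs n T x = {y. y < n \<and> (\<exists>d\<in>T. y = x + d \<or> x = y + d)}"

text \<open>Each distance \<open>d\<close> gives at most one neighbour above \<open>x\<close> and
  one below. These differ because \<open>d\<close> is positive, and different distances give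
  different neighbours.\<close>

lemma card_distance_nbrs:
  assumes "finite T" "0 \<notin> T" "x < n"
  shows "card (distance_nbrs n T x) = (\<Sum>d\<in>T. of_bool (x + d < n) + of_bool (d \<le> x))"
  using assms(1,2)
proof (induction T)
  case empty
  then show ?case by (simp add: distance_nbrs_def)
next
  case (insert d T)
  let ?N = "{y. y < n \<and> (y = x + d \<or> x = y + d)}"
  have split: "distance_nbrs n (insert d T) x = ?N \<union> distance_nbrs n T x"
    by (auto simp: distance_nbrs_def)
  have fin: "finite (distance_nbrs n T x)"
    by (simp add: distance_nbrs_def)
  have disj: "?N \<inter> distance_nbrs n T x = {}"
    using insert by (auto simp: distance_nbrs_def)
  have "?N = (if x + d < n then {x + d} else {}) \<union> (if d \<le> x then {x - d} else {})"
    using \<open>x < n\<close> by auto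
  then have "card ?N = card ((if x + d < n then {x + d} else {}) \<union> (if d \<le> x then {x - d} else {}))"
    by (rule arg_cong)
  also have "\<dots> = of_bool (x + d < n) + of_bool (d \<le> x)"
    using insert.prems by auto
  finally have "card ?N = of_bool (x + d < n) + of_bool (d \<le> x)" .
  then show ?case
    using insert.IH insert.hyps insert.prems fin unfolding split
    by (subst card_Un_disjoint[OF _ _ disj]) simp_all
qed

text \<open>The distances \<open>d\<close> and \<open>n - d\<close> together contribute 2:
  \<open>x + d < n\<close> is the negation of \<open>n - d \<le> x\<close>, and
  \<open>x + (n - d) < n\<close> is the negation of \<open>d \<le> x\<close>. The bound on
  \<open>h\<close> keeps the \<open>h\<close> pairs of distances disjoint.\<close>

lemma circulant_degree:
  fixes h n x :: nat
  assumes "2 * h < n"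
  shows "(\<Sum>d\<in>{1..h} \<union> {n - h..<n}. of_bool (x + d < n) + of_bool (d \<le> x)) = 2 * h"
  using assms
proof (induction h)
  case (Suc h)
  let ?C = "{1..h} \<union> {n - h..<n}"
  let ?c = "\<lambda>d. of_bool (x + d < n) + of_bool (d \<le> x) :: nat"
  have "{1..Suc h} \<union> {n - Suc h..<n} = insert (Suc h) (insert (n - Suc h) ?C)"
    using Suc.prems by auto
  then have "sum ?c ({1..Suc h} \<union> {n - Suc h..<n}) = sum ?c (insert (Suc h) (insert (n - Suc h) ?C))"
    by (rule arg_cong)
  also have "\<dots> = ?c (Suc h) + (?c (n - Suc h) + sum ?c ?C)"
  proof -
    have "finite ?C" "Suc h \<notin> insert (n - Suc h) ?C" "n - Suc h \<notin> ?C"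
      using Suc.prems by auto
    then show ?thesis by (simp only: sum.insert finite_insert simp_thms)
  qed
  also have "sum ?c ?C = 2 * h"
    using Suc by simp
  also have "?c (Suc h) + (?c (n - Suc h) + 2 * h) = 2 * Suc h"
    using Suc.prems by auto
  finally show ?case .
qed simp

text \<open>The apex is \<open>n\<close>. For \<open>n\<close> = \<Delta> it has degree \<Delta>,
  and the \<Delta> base vertices are just as many as the lower bounds count.\<close>

definition cone :: "nat \<Rightarrow> nat set \<Rightarrow> nat pair_pre_digraph" where
  "cone n T = \<lparr> pverts = {..n},
     parcs = {(x, y). x \<le> n \<and> y \<le> n \<and> x \<noteq> y \<and> (x = n \<or> y = n \<or> y \<in> distance_nbrs n T x)} \<rparr>"

lemma pverts_cone [simp]: "pverts (cone n T) = {..n}"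
  by (simp add: cone_def)

lemma nonempty_graph_cone:
  assumes "1 \<le> n"
  shows "nonempty_graph (cone n T)"
proof -
  have "finite (parcs (cone n T))"
    by (rule finite_subset[of _ "{..n} \<times> {..n}"]) (auto simp: cone_def)
  then have "pair_graph (cone n T)"
    by unfold_locales (auto simp: cone_def distance_nbrs_def symmetric_def sym_def)
  moreover have "(0, n) \<in> parcs (cone n T)"
    using assms by (simp add: cone_def)
  ultimately show ?thesis
    by (auto simp: nonempty_graph_def)
qed

lemma vdegree_cone_apex: "vdegree (cone n T) n = n"
proof -
  have "{y. (n, y) \<in> parcs (cone n T)} = {..<n}"
    by (auto simp: cone_def)
  then show ?thesis by (simp add: vdegree_eq_card)
qed

text \<open>The successor accounts for the apex. As 0 is not a distance, no base vertex is its own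
  neighbour and excluding loops removes nothing.\<close>

lemma vdegree_cone_base:
  assumes "0 \<notin> T" "x < n"
  shows "vdegree (cone n T) x = Suc (card (distance_nbrs n T x))"
proof -
  have "{y. (x, y) \<in> parcs (cone n T)} = insert n (distance_nbrs n T x)"
    using assms by (auto simp: cone_def distance_nbrs_def)
  moreover have "finite (distance_nbrs n T x)" "n \<notin> distance_nbrs n T x"
    by (auto simp: distance_nbrs_def)
  ultimately show ?thesis by (simp add: vdegree_eq_card)
qed

lemma circulant_cone:
  assumes "2 * h < n"
  obtains T where "\<And>x. x < n \<Longrightarrow> vdegree (cone n T) x = 2 * h + 1"
proof
  fix x assume "x < n"
  then show "vdegree (cone n ({1..h} \<union> {n - h..<n})) x = 2 * h + 1"
    using assms circulant_degree[OF assms, of x]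
    by (simp add: vdegree_cone_base card_distance_nbrs)
qed

lemma circulant_matching_cone:
  assumes "h < n div 2"
  obtains T where
    "\<And>x. x < n \<Longrightarrow> vdegree (cone n T) x = (if odd n \<and> x = n div 2 then 2 * h + 3 else 2 * h + 2)"
proof
  let ?T = "{1..h} \<union> {n - h..<n}"
  fix x assume x: "x < n"
  \<comment> \<open>From \<open>h < n div 2\<close> follows \<open>h < n div 2 < n - h\<close>, so
    the middle distance is new.\<close>
  have T: "n div 2 \<notin> ?T" "0 \<notin> insert (n div 2) ?T" and h: "2 * h < n" using assms by auto
  have "vdegree (cone n (insert (n div 2) ?T)) x
      = Suc (of_bool (x + n div 2 < n) + of_bool (n div 2 \<le> x) + 2 * h)"
    using x T circulant_degree[OF h, of x]
    by (simp add: vdegree_cone_base card_distance_nbrs del: Un_iff)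
  \<comment> \<open>For even \<open>n\<close> exactly one of the two conditions holds. For n = 2m +
    1 they read x \<le> m and m \<le> x, so both hold only at m.\<close>
  also have "\<dots> = (if odd n \<and> x = n div 2 then 2 * h + 3 else 2 * h + 2)"
    by (cases "even n") (auto elim!: evenE oddE)
  finally show "vdegree (cone n (insert (n div 2) ?T)) x
    = (if odd n \<and> x = n div 2 then 2 * h + 3 else 2 * h + 2)" .
qed

text \<open>The parity condition says that \<delta> is odd, where a circulant suffices, or that
  \<Delta> is even, where a perfect matching can be added.\<close>

lemma extremal_even:
  assumes "1 \<le> \<delta>" "\<delta> < \<Delta>" "even (\<Delta> * (\<delta> + 1))"
  shows "\<exists>T. \<forall>x<\<Delta>. vdegree (cone \<Delta> T) x = \<delta>"
proof (cases "odd \<delta>")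
  case True
  then obtain h where "\<delta> = 2 * h + 1" by (elim oddE)
  then show ?thesis using circulant_cone[of h \<Delta>] assms by (metis add_lessD1)
next
  case False
  then obtain k where k: "\<delta> = 2 * k" by auto
  have "even \<Delta>" using False assms by simp
  \<comment> \<open>Apex and matching supply two of the 2k edges at a base vertex, leaving 2(k - 1)
    for the circulant. Here k \<ge> 1 since \<delta> \<ge> 1, so nothing is truncated.\<close>
  moreover have "k - 1 < \<Delta> div 2" "2 * (k - 1) + 2 = \<delta>" using k assms by auto
  ultimately show ?thesis using circulant_matching_cone[of "k - 1" \<Delta>] by metis
qed

lemma extremal_odd:
  assumes "1 \<le> \<delta>" "\<delta> < \<Delta>" "odd (\<Delta> * (\<delta> + 1))"
  shows "\<exists>T. \<exists>m<\<Delta>. \<forall>x<\<Delta>. vdegree (cone \<Delta> T) x = (if x = m then \<delta> + 1 else \<delta>)"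
proof -
  from assms have "odd \<Delta>" "even \<delta>" by auto
  then obtain k where k: "\<delta> = 2 * k" by auto
  have k': "k - 1 < \<Delta> div 2" "2 * (k - 1) + 2 = \<delta>" "2 * (k - 1) + 3 = \<delta> + 1"
    using k assms by auto
  obtain T where "\<forall>x<\<Delta>. vdegree (cone \<Delta> T) x = (if x = \<Delta> div 2 then \<delta> + 1 else \<delta>)"
    using circulant_matching_cone[OF k'(1)] \<open>odd \<Delta>\<close> unfolding k'(2,3) by auto
  moreover have "\<Delta> div 2 < \<Delta>" using assms by simp
  ultimately show ?thesis by blast
qed

section \<open>Attainment of the bounds by cones\<close>

lemma degree_bounds_attained:
  assumes "finite (pverts G)"
    and "\<And>x. x \<in> pverts G \<Longrightarrow> vdegree G u \<le> vdegree G x \<and> vdegree G x \<le> vdegree G w"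
    and "u \<in> pverts G" "w \<in> pverts G"
  shows "min_degree G = vdegree G u" "max_degree G = vdegree G w"
  using assms by (auto simp: min_degree_def max_degree_def intro!: Min_eqI Max_eqI)

lemma prod_cone:
  fixes f :: "nat \<Rightarrow> nat"
  shows "(\<Prod>u\<in>{..n}. f (vdegree (cone n T) u)) = (\<Prod>u<n. f (vdegree (cone n T) u)) * f n"
  by (simp add: lessThan_Suc_atMost[symmetric] vdegree_cone_apex)

text \<open>The product formula ranges over all \<open>f\<close>, so that one graph attains the
  bounds for all three indices at once.\<close>

lemma sharp_even:
  assumes "1 \<le> \<delta>" "\<delta> < \<Delta>" "even (\<Delta> * (\<delta> + 1))"
  obtains G :: "nat pair_pre_digraph"
  where "nonempty_graph G" "min_degree G = \<delta>" "max_degree G = \<Delta>"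
    "\<And>f :: nat \<Rightarrow> nat. (\<Prod>u\<in>pverts G. f (vdegree G u)) = f \<delta> ^ \<Delta> * f \<Delta>"
proof -
  obtain T where T: "\<forall>x<\<Delta>. vdegree (cone \<Delta> T) x = \<delta>"
    using extremal_even[OF assms] by blast
  let ?G = "cone \<Delta> T"
  have deg: "vdegree ?G x = (if x = \<Delta> then \<Delta> else \<delta>)" if "x \<le> \<Delta>" for x
    using that T by (simp add: vdegree_cone_apex)
  have "min_degree ?G = \<delta>" "max_degree ?G = \<Delta>"
    using degree_bounds_attained[of ?G 0 \<Delta>] assms by (simp_all add: deg)
  moreover have "(\<Prod>u\<in>pverts ?G. f (vdegree ?G u)) = f \<delta> ^ \<Delta> * f \<Delta>" for f :: "nat \<Rightarrow> nat"
    by (simp add: prod_cone T)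
  ultimately show thesis
    using that nonempty_graph_cone[of \<Delta> T] assms by simp
qed

lemma sharp_odd:
  assumes "1 \<le> \<delta>" "\<delta> < \<Delta>" "odd (\<Delta> * (\<delta> + 1))"
  obtains G :: "nat pair_pre_digraph"
  where "nonempty_graph G" "min_degree G = \<delta>" "max_degree G = \<Delta>"
    "\<And>f :: nat \<Rightarrow> nat. (\<Prod>u\<in>pverts G. f (vdegree G u)) = f \<delta> ^ (\<Delta> - 1) * f (\<delta> + 1) * f \<Delta>"
proof -
  obtain T m where m: "m < \<Delta>"
    and T: "\<forall>x<\<Delta>. vdegree (cone \<Delta> T) x = (if x = m then \<delta> + 1 else \<delta>)"
    using extremal_odd[OF assms] by blast
  let ?G = "cone \<Delta> T"
  have deg: "vdegree ?G x = (if x = \<Delta> then \<Delta> else if x = m then \<delta> + 1 else \<delta>)" if "x \<le> \<Delta>" for x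
    using that T by (simp add: vdegree_cone_apex)
  \<comment> \<open>A base vertex other than \<open>m\<close> is needed to attain the minimum degree
    \<delta>; one of 0 and 1 serves, since \<Delta> \<ge> 2. The degree \<delta> + 1 of
    \<open>m\<close> stays within \<Delta>.\<close>
  define x where "x = (if m = 0 then 1 else 0 :: nat)"
  have "x < \<Delta>" "x \<noteq> m" using assms by (auto simp: x_def)
  then have "min_degree ?G = \<delta>" "max_degree ?G = \<Delta>"
    using degree_bounds_attained[of ?G x \<Delta>] assms by (simp_all add: deg)
  moreover have "(\<Prod>u\<in>pverts ?G. f (vdegree ?G u)) = f \<delta> ^ (\<Delta> - 1) * f (\<delta> + 1) * f \<Delta>"
    for f :: "nat \<Rightarrow> nat"
  proof -
    have "(\<Prod>u<\<Delta>. f (vdegree ?G u)) = f (\<delta> + 1) * (\<Prod>u\<in>{..<\<Delta>} - {m}. f \<delta>)"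
      using m T by (simp add: prod.remove[of _ m])
    then show ?thesis using m by (simp add: prod_cone)
  qed
  ultimately show thesis
    using that nonempty_graph_cone[of \<Delta> T] assms by simp
qed

section \<open>Specialisation to the three indices\<close>

theorem theorem3p3:
  fixes \<delta> \<Delta> :: nat
  assumes "1 \<le> \<delta>" and "\<delta> < \<Delta>"
  shows
    "(even (\<Delta> * (\<delta> + 1)) \<longrightarrow>
        (\<forall>G :: 'a pair_pre_digraph.
           nonempty_graph G \<and> min_degree G = \<delta> \<and> max_degree G = \<Delta> \<longrightarrow>
             Pi1 G \<ge> \<delta> ^ (2 * \<Delta>) * \<Delta>\<^sup>2 \<and>
             NK G \<ge> \<delta> ^ \<Delta> * \<Delta> \<and>
             NK_star G \<ge> \<delta> ^ (\<delta> * \<Delta>) * \<Delta> ^ \<Delta>) \<and>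
        (\<exists>G :: nat pair_pre_digraph.
           nonempty_graph G \<and> min_degree G = \<delta> \<and> max_degree G = \<Delta> \<and>
             Pi1 G = \<delta> ^ (2 * \<Delta>) * \<Delta>\<^sup>2 \<and>
             NK G = \<delta> ^ \<Delta> * \<Delta> \<and>
             NK_star G = \<delta> ^ (\<delta> * \<Delta>) * \<Delta> ^ \<Delta>)) \<and>
     (odd (\<Delta> * (\<delta> + 1)) \<longrightarrow>
        (\<forall>G :: 'a pair_pre_digraph.
           nonempty_graph G \<and> min_degree G = \<delta> \<and> max_degree G = \<Delta> \<longrightarrow>
             Pi1 G \<ge> \<delta> ^ (2 * (\<Delta> - 1)) * (\<delta> + 1)\<^sup>2 * \<Delta>\<^sup>2 \<and>
             NK G \<ge> \<delta> ^ (\<Delta> - 1) * (\<delta> + 1) * \<Delta> \<and>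
             NK_star G \<ge> \<delta> ^ (\<delta> * (\<Delta> - 1)) * (\<delta> + 1) ^ (\<delta> + 1) * \<Delta> ^ \<Delta>) \<and>
        (\<exists>G :: nat pair_pre_digraph.
           nonempty_graph G \<and> min_degree G = \<delta> \<and> max_degree G = \<Delta> \<and>
             Pi1 G = \<delta> ^ (2 * (\<Delta> - 1)) * (\<delta> + 1)\<^sup>2 * \<Delta>\<^sup>2 \<and>
             NK G = \<delta> ^ (\<Delta> - 1) * (\<delta> + 1) * \<Delta> \<and>
             NK_star G = \<delta> ^ (\<delta> * (\<Delta> - 1)) * (\<delta> + 1) ^ (\<delta> + 1) * \<Delta> ^ \<Delta>))"
proof (intro conjI impI allI; (elim conjE)?)
  fix G :: "'a pair_pre_digraph"
  assume G: "nonempty_graph G" "min_degree G = \<delta>" "max_degree G = \<Delta>"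
  \<comment> \<open>In each instance \<open>power_mult\<close> turns the exponents 2\<Delta> and
    \<delta>\<Delta>, or those with \<Delta> - 1 for \<Delta>, into powers of
    \<open>f \<delta>\<close>.\<close>
  note ge = degree_product_ge[OF G assms(1)]
  show "\<delta> ^ (2 * \<Delta>) * \<Delta>\<^sup>2 \<le> Pi1 G"
    using ge(1)[of "\<lambda>d. d\<^sup>2"] by (simp add: Pi1_def power_mult)
  show "\<delta> ^ \<Delta> * \<Delta> \<le> NK G"
    using ge(1)[of "\<lambda>d. d"] by (simp add: NK_def)
  show "\<delta> ^ (\<delta> * \<Delta>) * \<Delta> ^ \<Delta> \<le> NK_star G"
    using ge(1)[of "\<lambda>d. d ^ d"] by (simp add: NK_star_def power_mult self_power_mono)
  assume odd: "odd (\<Delta> * (\<delta> + 1))"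
  show "\<delta> ^ (2 * (\<Delta> - 1)) * (\<delta> + 1)\<^sup>2 * \<Delta>\<^sup>2 \<le> Pi1 G"
    using ge(2)[of "\<lambda>d. d\<^sup>2", OF _ _ odd] by (simp add: Pi1_def power_mult)
  show "\<delta> ^ (\<Delta> - 1) * (\<delta> + 1) * \<Delta> \<le> NK G"
    using ge(2)[of "\<lambda>d. d", OF _ _ odd] by (simp add: NK_def)
  show "\<delta> ^ (\<delta> * (\<Delta> - 1)) * (\<delta> + 1) ^ (\<delta> + 1) * \<Delta> ^ \<Delta> \<le> NK_star G"
    using ge(2)[of "\<lambda>d. d ^ d", OF self_power_mono _ odd]
    by (simp add: NK_star_def power_mult)
next
  assume "even (\<Delta> * (\<delta> + 1))"
  then obtain G :: "nat pair_pre_digraph"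
    where "nonempty_graph G" "min_degree G = \<delta>" "max_degree G = \<Delta>"
      and P: "\<And>f :: nat \<Rightarrow> nat. (\<Prod>u\<in>pverts G. f (vdegree G u)) = f \<delta> ^ \<Delta> * f \<Delta>"
    using sharp_even assms by blast
  moreover have "Pi1 G = \<delta> ^ (2 * \<Delta>) * \<Delta>\<^sup>2" "NK G = \<delta> ^ \<Delta> * \<Delta>"
    "NK_star G = \<delta> ^ (\<delta> * \<Delta>) * \<Delta> ^ \<Delta>"
    using P[of "\<lambda>d. d\<^sup>2"] P[of "\<lambda>d. d"] P[of "\<lambda>d. d ^ d"]
    by (simp_all add: Pi1_def NK_def NK_star_def power_mult)
  ultimately show "\<exists>G :: nat pair_pre_digraph.
      nonempty_graph G \<and> min_degree G = \<delta> \<and> max_degree G = \<Delta> \<and>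
      Pi1 G = \<delta> ^ (2 * \<Delta>) * \<Delta>\<^sup>2 \<and> NK G = \<delta> ^ \<Delta> * \<Delta> \<and>
      NK_star G = \<delta> ^ (\<delta> * \<Delta>) * \<Delta> ^ \<Delta>"
    by blast
next
  assume "odd (\<Delta> * (\<delta> + 1))"
  then obtain G :: "nat pair_pre_digraph"
    where "nonempty_graph G" "min_degree G = \<delta>" "max_degree G = \<Delta>"
      and P: "\<And>f :: nat \<Rightarrow> nat.
        (\<Prod>u\<in>pverts G. f (vdegree G u)) = f \<delta> ^ (\<Delta> - 1) * f (\<delta> + 1) * f \<Delta>"
    using sharp_odd assms by blast
  moreover have "Pi1 G = \<delta> ^ (2 * (\<Delta> - 1)) * (\<delta> + 1)\<^sup>2 * \<Delta>\<^sup>2"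
    "NK G = \<delta> ^ (\<Delta> - 1) * (\<delta> + 1) * \<Delta>"
    "NK_star G = \<delta> ^ (\<delta> * (\<Delta> - 1)) * (\<delta> + 1) ^ (\<delta> + 1) * \<Delta> ^ \<Delta>"
    using P[of "\<lambda>d. d\<^sup>2"] P[of "\<lambda>d. d"] P[of "\<lambda>d. d ^ d"]
    by (simp_all add: Pi1_def NK_def NK_star_def power_mult)
  ultimately show "\<exists>G :: nat pair_pre_digraph.
      nonempty_graph G \<and> min_degree G = \<delta> \<and> max_degree G = \<Delta> \<and>
      Pi1 G = \<delta> ^ (2 * (\<Delta> - 1)) * (\<delta> + 1)\<^sup>2 * \<Delta>\<^sup>2 \<and>
      NK G = \<delta> ^ (\<Delta> - 1) * (\<delta> + 1) * \<Delta> \<and>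
      NK_star G = \<delta> ^ (\<delta> * (\<Delta> - 1)) * (\<delta> + 1) ^ (\<delta> + 1) * \<Delta> ^ \<Delta>"
    by blast
qed

end
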